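(* Let $G=(V,E)$ be a non-oriented, countable, locally finite, connected graph. For all $f,g\in C_c(V)$ we have $$(df,dg)=\langle \Delta f,g\rangle ,$$ and hence the self-adjoint operator $\bar\Delta$ is positive, i.e. $\langle \bar\Delta f,f\rangle\ge 0$ for all $f$ in its domain.
   Context: For $x,y\in V$, $x\sim y$ means that $x$ and $y$ are joined by an edge; $m(x)=\#\{y\in V: y\sim x\}<\infty$. $\ell^2(V)$ is the complex Hilbert space of square summable functions $f:V\to\mathbb{C}$ with inner product $\langle f,g\rangle=\sum_{x\in V} f(x)\overline{g(x)}$, and $C_c(V)$ is the subspace of functions with finite support. The (physical) Laplacian is $\Delta f(x)=\sum_{y\sim x}(f(x)-f(y))$. The operator $\Delta$ with domain $C_c(V)$ is essentially self-adjoint on $\ell^2(V)$, and $\bar\Delta$ denotes its unique self-adjoint extension; its domain is $\mathcal{D}=\{f\in\ell^2(V):\Delta f\in\ell^2(V)\}$ and $\bar\Delta f=\Delta f$. $E_0=\{[x,y],[y,x] : x,y\in V,\ x\sim y\}$ is the set of oriented edges (each edge of $E$ gives two oriented edges), with the notation $-[x,y]=[y,x]$. $\ell^2(E_0)$ is the Hilbert space of functions $\phi:E_0\to\mathbb{C}$ with $\phi(-e)=-\phi(e)$ and $\sum_{e}|\phi(e)|^2<\infty$, with inner product $(\phi,\psi)=\frac12\sum_{e\in E_0}\phi(e)\overline{\psi(e)}$. The co-boundary operator $d:C_c(V)\to\ell^2(E_0)$ is $df([x,y])=f(x)-f(y)$. *)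

theory Defs
  imports "HOL-Analysis.Analysis"
begin

text \<open>An edge is a two-element set of vertices: no orientation, no loops, no multiple edges.
  The relation \<open>x \<sim> y\<close> is \<open>{x, y} \<in> E\<close>.\<close>

locale locally_finite_graph =
  fixes V :: "'a set" and E :: "'a set set"
  assumes edge: "e \<in> E \<Longrightarrow> e \<subseteq> V \<and> card e = 2"
    and countable_vertices: "countable V"
    and locally_finite: "x \<in> V \<Longrightarrow> finite {y \<in> V. {x, y} \<in> E}"
    and connected: "x \<in> V \<Longrightarrow> y \<in> V \<Longrightarrow> (x, y) \<in> {(u, v). {u, v} \<in> E}\<^sup>*"

text \<open>A function on \<open>V\<close> (or on the oriented edges) is represented by its extension by zero,
  so that equality of HOL functions is equality of functions on \<open>V\<close>.\<close>

definition ell2 :: "'a set \<Rightarrow> ('a \<Rightarrow> complex) set" where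
  "ell2 V = {f. (\<forall>x. x \<notin> V \<longrightarrow> f x = 0) \<and> (\<lambda>x. (cmod (f x))\<^sup>2) summable_on V}"

definition ell2_inner :: "'a set \<Rightarrow> ('a \<Rightarrow> complex) \<Rightarrow> ('a \<Rightarrow> complex) \<Rightarrow> complex" where
  "ell2_inner V f g = (\<Sum>\<^sub>\<infinity>x\<in>V. f x * cnj (g x))"

definition ell2_norm :: "'a set \<Rightarrow> ('a \<Rightarrow> complex) \<Rightarrow> real" where
  "ell2_norm V f = sqrt (Re (ell2_inner V f f))"

definition finsupp :: "'a set \<Rightarrow> ('a \<Rightarrow> complex) set" where
  "finsupp V = {f. (\<forall>x. x \<notin> V \<longrightarrow> f x = 0) \<and> finite {x \<in> V. f x \<noteq> 0}}"

definition laplacian :: "'a set set \<Rightarrow> ('a \<Rightarrow> complex) \<Rightarrow> 'a \<Rightarrow> complex" where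
  "laplacian E f x = (\<Sum>y | {x, y} \<in> E. f x - f y)"

definition oriented_edges :: "'a set set \<Rightarrow> ('a \<times> 'a) set" where
  "oriented_edges E = {(x, y). {x, y} \<in> E}"

definition ell2_edges :: "'a set set \<Rightarrow> ('a \<times> 'a \<Rightarrow> complex) set" where
  "ell2_edges E = {\<phi>. (\<forall>e. e \<notin> oriented_edges E \<longrightarrow> \<phi> e = 0)
      \<and> (\<forall>(x, y) \<in> oriented_edges E. \<phi> (y, x) = - \<phi> (x, y))
      \<and> (\<lambda>e. (cmod (\<phi> e))\<^sup>2) summable_on oriented_edges E}"

definition edge_inner ::
    "'a set set \<Rightarrow> ('a \<times> 'a \<Rightarrow> complex) \<Rightarrow> ('a \<times> 'a \<Rightarrow> complex) \<Rightarrow> complex" where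
  "edge_inner E \<phi> \<psi> = 1 / 2 * (\<Sum>\<^sub>\<infinity>e\<in>oriented_edges E. \<phi> e * cnj (\<psi> e))"

definition coboundary :: "'a set set \<Rightarrow> ('a \<Rightarrow> complex) \<Rightarrow> 'a \<times> 'a \<Rightarrow> complex" where
  "coboundary E f = (\<lambda>(x, y). if (x, y) \<in> oriented_edges E then f x - f y else 0)"

text \<open>An unbounded operator on \<open>\<ell>\<^sup>2(V)\<close> is identified with its graph: \<open>(f, h) \<in> T\<close> means that
  \<open>f\<close> is in the domain of \<open>T\<close> and \<open>T f = h\<close>. The domain is then \<open>Domain T\<close>, and
  ``\<open>A\<close> extends \<open>T\<close>'' is \<open>T \<subseteq> A\<close>.\<close>

type_synonym 'a operator = "(('a \<Rightarrow> complex) \<times> ('a \<Rightarrow> complex)) set"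

definition linear_operator :: "'a set \<Rightarrow> 'a operator \<Rightarrow> bool" where
  "linear_operator V T \<longleftrightarrow> T \<subseteq> ell2 V \<times> ell2 V \<and> single_valued T
     \<and> ((\<lambda>_. 0), (\<lambda>_. 0)) \<in> T
     \<and> (\<forall>(f, f') \<in> T. \<forall>(g, g') \<in> T. ((\<lambda>x. f x + g x), (\<lambda>x. f' x + g' x)) \<in> T)
     \<and> (\<forall>c. \<forall>(f, f') \<in> T. ((\<lambda>x. c * f x), (\<lambda>x. c * f' x)) \<in> T)"

definition densely_defined :: "'a set \<Rightarrow> 'a operator \<Rightarrow> bool" where
  "densely_defined V T \<longleftrightarrow>
     (\<forall>f \<in> ell2 V. \<forall>\<epsilon>>0. \<exists>g \<in> Domain T. ell2_norm V (\<lambda>x. f x - g x) < \<epsilon>)"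

definition adjoint_op :: "'a set \<Rightarrow> 'a operator \<Rightarrow> 'a operator" where
  "adjoint_op V T = {(g, h) \<in> ell2 V \<times> ell2 V.
     \<forall>(f, f') \<in> T. ell2_inner V f' g = ell2_inner V f h}"

definition self_adjoint :: "'a set \<Rightarrow> 'a operator \<Rightarrow> bool" where
  "self_adjoint V T \<longleftrightarrow> linear_operator V T \<and> densely_defined V T \<and> adjoint_op V T = T"

definition positive_operator :: "'a set \<Rightarrow> 'a operator \<Rightarrow> bool" where
  "positive_operator V T \<longleftrightarrow> (\<forall>(f, h) \<in> T. ell2_inner V h f \<in> \<real>\<^sub>\<ge>\<^sub>0)"

definition laplacian_op :: "'a set \<Rightarrow> 'a set set \<Rightarrow> 'a operator" where
  "laplacian_op V E = {(f, laplacian E f) | f. f \<in> finsupp V}"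

text \<open>The description is well defined because \<open>laplacian_op V E\<close> is essentially self-adjoint
  for every graph in \<open>locally_finite_graph\<close>.\<close>

definition bar_laplacian :: "'a set \<Rightarrow> 'a set set \<Rightarrow> 'a operator" where
  "bar_laplacian V E = (THE A. self_adjoint V A \<and> laplacian_op V E \<subseteq> A)"

context locally_finite_graph
begin

lemma edge_vertices: "{x, y} \<in> E \<Longrightarrow> x \<in> V \<and> y \<in> V"
  using edge by blast

lemma finite_neighbours: "finite {y. {x, y} \<in> E}"
proof (cases "x \<in> V")
  case True
  have "{y. {x, y} \<in> E} = {y \<in> V. {x, y} \<in> E}"
    using edge_vertices by blast
  with locally_finite[OF True] show ?thesis by simp
next
  case False
  then have "{y. {x, y} \<in> E} = {}" using edge_vertices by blast
  then show ?thesis by (metis finite.emptyI)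
qed

lemma finsupp_ell2:
  assumes "f \<in> finsupp V"
  shows "f \<in> ell2 V"
proof -
  have "(\<lambda>x. (cmod (f x))\<^sup>2) summable_on {x \<in> V. f x \<noteq> 0}"
    using assms by (intro summable_on_finite) (simp add: finsupp_def)
  also have "?this \<longleftrightarrow> (\<lambda>x. (cmod (f x))\<^sup>2) summable_on V"
    by (rule summable_on_cong_neutral) auto
  finally show ?thesis using assms by (simp add: ell2_def finsupp_def)
qed

lemma laplacian_finsupp:
  assumes "f \<in> finsupp V"
  shows "laplacian E f \<in> finsupp V"
proof -
  let ?S = "{x \<in> V. f x \<noteq> 0}"
  have out: "f x = 0" if "x \<notin> ?S" for x
    using assms that by (auto simp: finsupp_def)
  have zero: "laplacian E f x = 0" if "x \<notin> ?S \<union> (\<Union>y\<in>?S. {z. {y, z} \<in> E})" for x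
    unfolding laplacian_def
  proof (rule sum.neutral, safe)
    fix y assume "{x, y} \<in> E"
    then have "y \<notin> ?S" using that by (auto simp: insert_commute)
    then show "f x - f y = 0" using out[of x] out[of y] that by simp
  qed
  have "finite (?S \<union> (\<Union>y\<in>?S. {z. {y, z} \<in> E}))"
    using assms finite_neighbours by (simp add: finsupp_def)
  then have "finite {x \<in> V. laplacian E f x \<noteq> 0}"
    by (rule rev_finite_subset) (use zero in blast)
  moreover have "laplacian E f x = 0" if "x \<notin> V" for x
    using that edge_vertices unfolding laplacian_def by (intro sum.neutral) blast
  ultimately show ?thesis by (simp add: finsupp_def)
qed

lemma laplacian_op_ell2: "laplacian_op V E \<subseteq> ell2 V \<times> ell2 V"
  using finsupp_ell2 laplacian_finsupp by (auto simp: laplacian_op_def)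

lemma coboundary_ell2_edges:
  assumes "f \<in> finsupp V"
  shows "coboundary E f \<in> ell2_edges E"
proof -
  let ?S = "{x \<in> V. f x \<noteq> 0}"
  let ?F = "(\<Union>x\<in>?S. (\<lambda>y. (x, y)) ` {y. {x, y} \<in> E} \<union> (\<lambda>y. (y, x)) ` {y. {x, y} \<in> E})"
  have out: "f x = 0" if "x \<notin> ?S" for x
    using assms that by (auto simp: finsupp_def)
  have sub: "?F \<subseteq> oriented_edges E"
    by (auto simp: oriented_edges_def insert_commute)
  have zero: "coboundary E f e = 0" if "e \<notin> ?F" for e
  proof (cases e)
    case (Pair x y)
    show ?thesis
    proof (cases "{x, y} \<in> E")
      case True
      then have "x \<notin> ?S" "y \<notin> ?S" using that Pair by (auto simp: insert_commute)
      then show ?thesis using out[of x] out[of y] Pair by (simp add: coboundary_def)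
    qed (simp add: Pair coboundary_def oriented_edges_def)
  qed
  have "finite ?F"
    using assms finite_neighbours by (simp add: finsupp_def)
  then have "(\<lambda>e. (cmod (coboundary E f e))\<^sup>2) summable_on ?F"
    by (rule summable_on_finite)
  also have "?this \<longleftrightarrow> (\<lambda>e. (cmod (coboundary E f e))\<^sup>2) summable_on oriented_edges E"
  proof (rule summable_on_cong_neutral)
    fix e assume "e \<in> oriented_edges E - ?F"
    then show "(cmod (coboundary E f e))\<^sup>2 = 0" using zero[of e] by simp
  next
    fix e assume "e \<in> ?F - oriented_edges E"
    then show "(cmod (coboundary E f e))\<^sup>2 = 0" using sub by blast
  qed simp
  finally show ?thesis
    by (auto simp: ell2_edges_def coboundary_def oriented_edges_def insert_commute)
qed

end

end

theory Submission
  imports Defs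
begin

text \<open>
  Green's formula is summation by parts over oriented edges. If \<open>f\<close> has finite support, only
  finitely many edges contribute to \<open>(df, dg)\<close>, and reversing edges shows that the two halves of
  \<open>cnj (g x - g y)\<close> contribute equally; what remains, \<open>\<Sum>\<^bsub>x \<sim> y\<^esub> (f x - f y) * cnj (g x)\<close>, is
  \<open>\<langle>\<Delta> f, g\<rangle>\<close> (\<open>green_left\<close>). Splitting the other factor instead gives \<open>\<langle>f, \<Delta> g\<rangle>\<close>
  (\<open>green_right\<close>). In both formulas \<open>g\<close> is arbitrary.

  For positivity the closure \<open>bar_laplacian\<close>, described as \<^emph>\<open>the\<close> self-adjoint extension, has to
  be identified, so the essential self-adjointness of \<open>\<Delta>\<close> on finitely supported functions is proved
  too. By \<open>green_right\<close> and \<open>green_left\<close> the adjoint of this operator is the maximal operator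
  \<open>f \<mapsto> \<Delta> f\<close> on \<open>{f. f \<in> \<ell>\<^sup>2 \<and> \<Delta> f \<in> \<ell>\<^sup>2}\<close>. Two ingredients show that the maximal operator is the
  closure of \<open>\<Delta>\<close> on finitely supported functions.

  \<^item> A maximum principle (\<open>laplacian_no_negative_eigenfunction\<close>): if \<open>\<Delta> r = - r\<close> with \<open>r \<in> \<ell>\<^sup>2\<close>,
    then \<open>(m(x) + 1) * r x = \<Sum>\<^bsub>y \<sim> x\<^esub> r y\<close>, which is impossible at a nonzero maximum of \<open>\<bar>r\<bar>\<close>;
    and a nonzero square-summable \<open>\<bar>r\<bar>\<close> attains its maximum.
  \<^item> A Hilbert space argument (\<open>adjoint_in_closure\<close>): let \<open>T\<close> be symmetric and nonnegative, and let
    the range of \<open>1 + T\<close> have trivial orthogonal complement. That range is then dense, and since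
    \<open>\<bar>f\<bar> \<le> \<bar>f + T f\<bar>\<close>, convergence of \<open>f\<^sub>n + T f\<^sub>n\<close> forces \<open>f\<^sub>n\<close> and \<open>T f\<^sub>n\<close> to converge. For a pair
    \<open>(g, h)\<close> of the adjoint, choosing \<open>f\<^sub>n + T f\<^sub>n\<close> convergent to \<open>g + h\<close> exhibits \<open>(g, h)\<close> as a
    limit of pairs \<open>(f\<^sub>n, T f\<^sub>n)\<close>.

  Consequently symmetry and nonnegativity pass from finitely supported functions to the maximal
  operator by continuity. Being symmetric and the adjoint of its restriction, the maximal operator is
  self-adjoint; any other self-adjoint extension lies below the adjoint, hence below the maximal
  operator, and by taking adjoints also above it.

  The Hilbert space argument only involves real parts of inner products, so it is carried out in a
  real Hilbert space; multiplication of a function by \<open>\<i>\<close> recovers the imaginary parts. The concrete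
  space is the type of square-summable functions on the whole vertex type, in which those on \<open>V\<close> are
  the functions vanishing off \<open>V\<close>; points off \<open>V\<close> behave as isolated vertices, where \<open>\<Delta> f\<close> is \<open>0\<close>.
\<close>

section \<open>Positive symmetric operators on a real Hilbert space\<close>

lemma parallelogram_law:
  fixes x y :: "'h::real_inner"
  shows "(norm (x + y))\<^sup>2 + (norm (x - y))\<^sup>2 = 2 * (norm x)\<^sup>2 + 2 * (norm y)\<^sup>2"
  by (simp add: power2_norm_eq_inner inner_add_left inner_add_right inner_diff_left inner_diff_right inner_commute)

text \<open>  The midpoint of two terms lies in \<open>R\<close>, so it is no closer to \<open>k\<close> than \<open>d\<close>; the parallelogram law
  turns this into a bound on the distance of the two terms.\<close>

lemma Cauchy_minimizing_sequence:
  fixes y :: "nat \<Rightarrow> 'h::real_inner"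
  assumes R: "subspace R" and y: "\<And>n. y n \<in> R"
    and lower: "\<And>z. z \<in> R \<Longrightarrow> d \<le> norm (k - z)" and d: "0 \<le> d"
    and lim: "(\<lambda>n. norm (k - y n)) \<longlonglongrightarrow> d"
  shows "Cauchy y"
proof (rule metric_CauchyI)
  fix e :: real assume e: "0 < e"
  have gap: "(norm (y m - y n))\<^sup>2 \<le> 2 * (norm (k - y m))\<^sup>2 + 2 * (norm (k - y n))\<^sup>2 - 4 * d\<^sup>2" for m n
  proof -
    let ?z = "(1/2) *\<^sub>R (y m + y n)"
    have "?z \<in> R"
      using R y by (intro subspace_scale subspace_add)
    then have "d\<^sup>2 \<le> (norm (k - ?z))\<^sup>2"
      using lower d by (intro power_mono)
    moreover have "(k - y m) + (k - y n) = 2 *\<^sub>R (k - ?z)"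
      by (simp add: algebra_simps scaleR_2)
    then have "(norm ((k - y m) + (k - y n)))\<^sup>2 = 4 * (norm (k - ?z))\<^sup>2"
      by (simp add: power_mult_distrib)
    moreover have "norm ((k - y m) - (k - y n)) = norm (y m - y n)"
      by (simp add: norm_minus_commute)
    ultimately show ?thesis
      using parallelogram_law[of "k - y m" "k - y n"] by simp
  qed
  have "(\<lambda>n. (norm (k - y n))\<^sup>2) \<longlonglongrightarrow> d\<^sup>2"
    using lim by (rule tendsto_power)
  then have "\<forall>\<^sub>F n in sequentially. (norm (k - y n))\<^sup>2 < d\<^sup>2 + e\<^sup>2 / 4"
    using e by (intro order_tendstoD) auto
  then obtain N where N: "\<And>n. n \<ge> N \<Longrightarrow> (norm (k - y n))\<^sup>2 < d\<^sup>2 + e\<^sup>2 / 4"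
    by (auto simp: eventually_sequentially)
  show "\<exists>N. \<forall>m\<ge>N. \<forall>n\<ge>N. dist (y m) (y n) < e"
  proof (intro exI allI impI)
    fix m n assume "N \<le> m" "N \<le> n"
    then have "(norm (y m - y n))\<^sup>2 < e\<^sup>2"
      using gap[of m n] N[of m] N[of n] by simp
    then show "dist (y m) (y n) < e"
      using e by (simp add: dist_norm power_less_imp_less_base)
  qed
qed

text \<open>  The multiple of \<open>z\<close> that is subtracted in the proof is the orthogonal projection of \<open>r\<close> onto the
  line through \<open>z\<close>; removing it would shorten \<open>r\<close> unless it is zero.\<close>

lemma orthogonal_if_closest:
  fixes r :: "'h::real_inner"
  assumes closest: "\<And>t. norm r \<le> norm (r - t *\<^sub>R z)"
  shows "inner z r = 0"
proof (cases "z = 0")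
  case False
  define t where "t = inner z r / inner z z"
  have zz: "inner z z > 0" using False by simp
  have "inner r r \<le> inner (r - t *\<^sub>R z) (r - t *\<^sub>R z)"
    using closest[of t] by (simp add: norm_eq_sqrt_inner)
  also have "\<dots> = inner r r - (inner z r)\<^sup>2 / inner z z"
    using zz by (simp add: t_def inner_diff_left inner_diff_right inner_commute power2_eq_square field_simps)
  finally have "(inner z r)\<^sup>2 / inner z z \<le> 0" by simp
  then show ?thesis using zz by (simp add: divide_le_0_iff)
qed simp

text \<open>  A minimizing sequence in \<open>R\<close> for the distance to \<open>k\<close> converges to some \<open>p\<close>, and the closest-point
  property makes \<open>k - p\<close> orthogonal to \<open>R\<close>, whence \<open>k = p\<close>.\<close>

lemma dense_subspace_if_trivial_complement:
  fixes R :: "'h::{real_inner, complete_space} set"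
  assumes R: "subspace R"
    and trivial: "\<And>r. (\<And>z. z \<in> R \<Longrightarrow> inner z r = 0) \<Longrightarrow> r = 0"
  shows "closure R = UNIV"
proof -
  have "k \<in> closure R" for k
  proof -
    define d where "d = (INF z\<in>R. norm (k - z))"
    have ne: "R \<noteq> {}" using R subspace_0 by blast
    have bdd: "bdd_below ((\<lambda>z. norm (k - z)) ` R)" by (rule bdd_belowI2[of _ 0]) simp
    have lower: "d \<le> norm (k - z)" if "z \<in> R" for z
      unfolding d_def using bdd that by (rule cINF_lower)
    have d0: "0 \<le> d" unfolding d_def using ne by (intro cINF_greatest) auto
    have "\<exists>z\<in>R. norm (k - z) < d + 1 / Suc n" for n
    proof -
      have "d < d + 1 / Suc n" by simp
      then show ?thesis unfolding d_def by (subst (asm) cINF_less_iff[OF ne bdd]) blast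
    qed
    then obtain y where y: "\<And>n. y n \<in> R" "\<And>n. norm (k - y n) < d + 1 / Suc n" by metis
    have upper: "(\<lambda>n. d + 1 / Suc n) \<longlonglongrightarrow> d"
      using tendsto_add[OF tendsto_const LIMSEQ_inverse_real_of_nat] by (simp add: inverse_eq_divide)
    have lim: "(\<lambda>n. norm (k - y n)) \<longlonglongrightarrow> d"
      by (rule tendsto_sandwich[OF _ _ tendsto_const upper])
        (use y lower in \<open>auto intro!: always_eventually less_imp_le\<close>)
    obtain p where p: "y \<longlonglongrightarrow> p"
      using Cauchy_minimizing_sequence[OF R y(1) lower d0 lim] Cauchy_convergent_iff convergent_def by blast
    have dist: "norm (k - p) = d"
      using tendsto_norm[OF tendsto_diff[OF tendsto_const p]] lim LIMSEQ_unique by blast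
    have pR: "p \<in> closure R" using y(1) p closure_sequential by blast
    have "inner z (k - p) = 0" if z: "z \<in> R" for z
    proof (rule orthogonal_if_closest)
      fix t
      have "(\<lambda>n. norm (k - (y n + t *\<^sub>R z))) \<longlonglongrightarrow> norm (k - (p + t *\<^sub>R z))"
        by (intro tendsto_intros p)
      moreover have "d \<le> norm (k - (y n + t *\<^sub>R z))" for n
        using R y(1) z by (intro lower subspace_add subspace_scale)
      ultimately have "d \<le> norm (k - (p + t *\<^sub>R z))"
        by (intro LIMSEQ_le_const) auto
      then show "norm (k - p) \<le> norm (k - p - t *\<^sub>R z)"
        by (simp add: dist algebra_simps)
    qed
    then have "k - p = 0" by (rule trivial)
    then show ?thesis using pR by simp
  qed
  then show ?thesis by blast
qed

text \<open>  This is von Neumann's criterion for a nonnegative operator, whose graph is \<open>T\<close>: triviality of the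
  deficiency space at \<open>- 1\<close> makes the adjoint coincide with the closure.\<close>

lemma adjoint_in_closure:
  fixes T :: "('h::{real_inner, complete_space} \<times> 'h) set"
  assumes T: "subspace T"
    and symmetric: "\<And>u u' v v'. (u, u') \<in> T \<Longrightarrow> (v, v') \<in> T \<Longrightarrow> inner u' v = inner u v'"
    and nonneg: "\<And>u u'. (u, u') \<in> T \<Longrightarrow> 0 \<le> inner u' u"
    and trivial: "\<And>r. (\<And>u u'. (u, u') \<in> T \<Longrightarrow> inner (u + u') r = 0) \<Longrightarrow> r = 0"
    and adjoint: "\<And>u u'. (u, u') \<in> T \<Longrightarrow> inner u' g = inner u h"
  shows "(g, h) \<in> closure T"
proof -
  let ?shift = "\<lambda>(u, u'). u + u'"
  have "linear ?shift"
    by (intro linearI) (auto simp: algebra_simps)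
  then have "subspace (?shift ` T)"
    using T by (rule linear_subspace_image)
  then have "closure (?shift ` T) = UNIV"
    by (rule dense_subspace_if_trivial_complement) (use trivial in fastforce)
  then obtain s where s: "\<And>n. s n \<in> ?shift ` T" "s \<longlonglongrightarrow> g + h"
    by (metis UNIV_I closure_sequential)
  then have "\<forall>n. \<exists>w\<in>T. s n = fst w + snd w" by (auto simp: image_iff split_beta)
  then obtain w where w: "\<And>n. w n \<in> T" "\<And>n. s n = fst (w n) + snd (w n)" by metis
  \<comment> \<open>Nonnegativity makes \<open>u + u' \<mapsto> u\<close> a contraction, so \<open>fst (w n)\<close> inherits convergence from \<open>s\<close>.\<close>
  have contract: "norm u \<le> norm (u + u')" if "(u, u') \<in> T" for u u'
  proof (cases "u = 0")
    case False
    have "norm u * norm u \<le> inner (u + u') u"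
      using nonneg[OF that] by (simp add: inner_add_left flip: power2_eq_square power2_norm_eq_inner)
    also have "\<dots> \<le> norm (u + u') * norm u" by (rule norm_cauchy_schwarz)
    finally show ?thesis using False by simp
  qed simp
  have "Cauchy (\<lambda>n. fst (w n))"
  proof (rule metric_CauchyI)
    fix e :: real assume "0 < e"
    then obtain N where N: "\<And>m n. m \<ge> N \<Longrightarrow> n \<ge> N \<Longrightarrow> dist (s m) (s n) < e"
      using LIMSEQ_imp_Cauchy[OF s(2)] by (meson metric_CauchyD)
    have "dist (fst (w m)) (fst (w n)) \<le> dist (s m) (s n)" for m n
    proof -
      have "(fst (w m) - fst (w n), snd (w m) - snd (w n)) \<in> T"
        using subspace_diff[OF T w(1) w(1), of m n] by (simp add: minus_prod_def)
      from contract[OF this] show ?thesis by (simp add: dist_norm w(2) algebra_simps)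
    qed
    then show "\<exists>N. \<forall>m\<ge>N. \<forall>n\<ge>N. dist (fst (w m)) (fst (w n)) < e"
      using N le_less_trans by blast
  qed
  then obtain f where f: "(\<lambda>n. fst (w n)) \<longlonglongrightarrow> f"
    using Cauchy_convergent_iff convergent_def by blast
  have f': "(\<lambda>n. snd (w n)) \<longlonglongrightarrow> g + h - f"
    using tendsto_diff[OF s(2) f] by (simp add: w(2))
  \<comment> \<open>Both \<open>(g, h)\<close> and the limit \<open>(f, g + h - f)\<close> are in the adjoint; their difference is \<open>(g - f, f - g)\<close>, a deficiency vector.\<close>
  have "g - f = 0"
  proof (rule trivial)
    fix u u' assume u: "(u, u') \<in> T"
    have "(\<lambda>n. inner u' (fst (w n))) \<longlonglongrightarrow> inner u' f"
      by (intro tendsto_intros f)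
    moreover have "(\<lambda>n. inner u (snd (w n))) \<longlonglongrightarrow> inner u (g + h - f)"
      by (intro tendsto_intros f')
    moreover have "inner u' (fst (w n)) = inner u (snd (w n))" for n
      using symmetric[OF u] w(1)[of n] by (metis prod.collapse)
    ultimately have "inner u' f = inner u (g + h - f)"
      using LIMSEQ_unique by simp
    then show "inner (u + u') (g - f) = 0"
      using adjoint[OF u] by (simp add: inner_add_left inner_diff_right inner_add_right)
  qed
  then have "w \<longlonglongrightarrow> (g, h)"
    using tendsto_Pair[OF f f'] by simp
  then show ?thesis using w(1) closure_sequential by blast
qed

lemma nonneg_on_closure:
  fixes T :: "('h::real_inner \<times> 'h) set"
  assumes "\<And>u u'. (u, u') \<in> T \<Longrightarrow> 0 \<le> inner u' u" and "(g, h) \<in> closure T"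
  shows "0 \<le> inner h g"
proof -
  obtain w where w: "\<And>n. w n \<in> T" "w \<longlonglongrightarrow> (g, h)"
    using assms(2) closure_sequential by blast
  have "(\<lambda>n. inner (snd (w n)) (fst (w n))) \<longlonglongrightarrow> inner h g"
    using tendsto_inner[OF tendsto_snd[OF w(2)] tendsto_fst[OF w(2)]] by simp
  then show ?thesis
    by (rule LIMSEQ_le_const) (use assms(1) w(1) in \<open>metis prod.collapse\<close>)
qed

lemma adjoint_pairing_on_closure:
  fixes T :: "('h::real_inner \<times> 'h) set"
  assumes "\<And>u u'. (u, u') \<in> T \<Longrightarrow> inner u' b = inner u b'" and "(g, h) \<in> closure T"
  shows "inner h b = inner g b'"
proof -
  obtain w where w: "\<And>n. w n \<in> T" "w \<longlonglongrightarrow> (g, h)"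
    using assms(2) closure_sequential by blast
  have "(\<lambda>n. inner (snd (w n)) b) \<longlonglongrightarrow> inner h b"
    using tendsto_inner[OF tendsto_snd[OF w(2)] tendsto_const] by simp
  moreover have "(\<lambda>n. inner (fst (w n)) b') \<longlonglongrightarrow> inner g b'"
    using tendsto_inner[OF tendsto_fst[OF w(2)] tendsto_const] by simp
  moreover have "inner (snd (w n)) b = inner (fst (w n)) b'" for n
    using assms(1) w(1)[of n] by (metis prod.collapse)
  ultimately show ?thesis using LIMSEQ_unique by simp
qed

section \<open>The Hilbert space of square-summable functions\<close>

lemma ell2_vanishes: "f \<in> ell2 V \<Longrightarrow> x \<notin> V \<Longrightarrow> f x = 0"
  by (simp add: ell2_def)

lemma ell2_summable: "f \<in> ell2 V \<Longrightarrow> (\<lambda>x. (cmod (f x))\<^sup>2) summable_on V"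
  by (simp add: ell2_def)

lemma ell2_mult_summable:
  assumes "f \<in> ell2 V" "g \<in> ell2 V"
  shows "(\<lambda>x. f x * cnj (g x)) summable_on V"
proof -
  have "(\<lambda>x. (cmod (f x))\<^sup>2 + (cmod (g x))\<^sup>2) summable_on V"
    using assms by (intro summable_on_add ell2_summable)
  then have "(\<lambda>x. norm (f x * cnj (g x))) summable_on V"
  proof (rule Infinite_Sum.abs_summable_on_comparison_test')
    fix x
    have "2 * cmod (f x) * cmod (g x) \<le> (cmod (f x))\<^sup>2 + (cmod (g x))\<^sup>2"
      by (rule sum_squares_bound)
    moreover have "0 \<le> cmod (f x) * cmod (g x)" by simp
    ultimately show "norm (f x * cnj (g x)) \<le> (cmod (f x))\<^sup>2 + (cmod (g x))\<^sup>2"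
      unfolding norm_mult complex_mod_cnj by linarith
  qed
  then show ?thesis by (rule abs_summable_summable)
qed

lemma ell2_zero: "(\<lambda>_. 0) \<in> ell2 V"
  by (simp add: ell2_def)

lemma ell2_scale:
  assumes "f \<in> ell2 V" shows "(\<lambda>x. c * f x) \<in> ell2 V"
  using assms by (auto simp: ell2_def norm_mult power_mult_distrib intro!: summable_on_cmult_right)

lemma ell2_add:
  assumes f: "f \<in> ell2 V" and g: "g \<in> ell2 V"
  shows "(\<lambda>x. f x + g x) \<in> ell2 V"
proof -
  have "(\<lambda>x. 2 * ((cmod (f x))\<^sup>2 + (cmod (g x))\<^sup>2)) summable_on V"
    using f g by (intro summable_on_cmult_right summable_on_add ell2_summable)
  then have "(\<lambda>x. norm ((cmod (f x + g x))\<^sup>2)) summable_on V"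
  proof (rule Infinite_Sum.abs_summable_on_comparison_test')
    fix x
    have "norm ((cmod (f x + g x))\<^sup>2) \<le> (cmod (f x + g x))\<^sup>2 + (cmod (f x - g x))\<^sup>2" by simp
    also have "\<dots> = 2 * ((cmod (f x))\<^sup>2 + (cmod (g x))\<^sup>2)"
      unfolding parallelogram_law by simp
    finally show "norm ((cmod (f x + g x))\<^sup>2) \<le> 2 * ((cmod (f x))\<^sup>2 + (cmod (g x))\<^sup>2)" .
  qed
  then show ?thesis using f g by (simp add: ell2_def)
qed

lemma ell2_diff: "f \<in> ell2 V \<Longrightarrow> g \<in> ell2 V \<Longrightarrow> (\<lambda>x. f x - g x) \<in> ell2 V"
  using ell2_add[of f V "\<lambda>x. - 1 * g x"] ell2_scale[of g V "- 1"] by simp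

lemma ell2_inner_add_left:
  assumes "f \<in> ell2 V" "g \<in> ell2 V" "h \<in> ell2 V"
  shows "ell2_inner V (\<lambda>x. f x + g x) h = ell2_inner V f h + ell2_inner V g h"
  unfolding ell2_inner_def distrib_right
  using assms by (intro infsum_add ell2_mult_summable)

lemma ell2_inner_scale_left: "ell2_inner V (\<lambda>x. c * f x) g = c * ell2_inner V f g"
  unfolding ell2_inner_def mult.assoc by (rule infsum_cmult_right')

lemma ell2_inner_commute: "ell2_inner V f g = cnj (ell2_inner V g f)"
  unfolding ell2_inner_def infsum_cnj[symmetric] by (simp add: mult.commute)

lemma Re_ell2_inner_self:
  assumes "f \<in> ell2 V"
  shows "Re (ell2_inner V f f) = (\<Sum>\<^sub>\<infinity>x\<in>V. (cmod (f x))\<^sup>2)"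
proof -
  have "Re (f x * cnj (f x)) = (cmod (f x))\<^sup>2" for x
    by (subst cmod_power2) (simp add: power2_eq_square)
  then show ?thesis
    using infsum_Re[OF ell2_mult_summable[OF assms assms]] by (simp only: ell2_inner_def)
qed

lemma ell2_mono:
  assumes "f \<in> ell2 V" "V \<subseteq> W" shows "f \<in> ell2 W"
proof -
  have "(\<lambda>x. (cmod (f x))\<^sup>2) summable_on V \<longleftrightarrow> (\<lambda>x. (cmod (f x))\<^sup>2) summable_on W"
    by (rule summable_on_cong_neutral) (use assms in \<open>auto simp: ell2_def\<close>)
  then show ?thesis using assms by (auto simp: ell2_def)
qed

lemma ell2_inner_eq_UNIV:
  assumes "\<And>x. x \<notin> V \<Longrightarrow> f x = 0 \<or> g x = 0"
  shows "ell2_inner V f g = ell2_inner UNIV f g"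
  unfolding ell2_inner_def by (rule infsum_cong_neutral) (use assms in auto)

text \<open>  Type classes require the Hilbert space to be a type, so the functions range over the whole vertex
  type; \<open>ell2_mono\<close> and \<open>ell2_inner_eq_UNIV\<close> embed \<open>ell2 V\<close> isometrically.\<close>

typedef 'a l2 = "ell2 (UNIV :: 'a set)" morphisms fun_of of_fun
  using ell2_zero by blast

setup_lifting type_definition_l2

instantiation l2 :: (type) real_inner
begin

lift_definition zero_l2 :: "'a l2" is "\<lambda>_. 0" by (rule ell2_zero)
lift_definition plus_l2 :: "'a l2 \<Rightarrow> 'a l2 \<Rightarrow> 'a l2" is "\<lambda>f g x. f x + g x" by (rule ell2_add)
lift_definition minus_l2 :: "'a l2 \<Rightarrow> 'a l2 \<Rightarrow> 'a l2" is "\<lambda>f g x. f x - g x" by (rule ell2_diff)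
lift_definition uminus_l2 :: "'a l2 \<Rightarrow> 'a l2" is "\<lambda>f x. - 1 * f x" by (rule ell2_scale)
lift_definition scaleR_l2 :: "real \<Rightarrow> 'a l2 \<Rightarrow> 'a l2" is "\<lambda>r f x. complex_of_real r * f x"
  by (rule ell2_scale)
lift_definition inner_l2 :: "'a l2 \<Rightarrow> 'a l2 \<Rightarrow> real" is "\<lambda>f g. Re (ell2_inner UNIV f g)" .

definition norm_l2 :: "'a l2 \<Rightarrow> real" where "norm_l2 f = sqrt (inner f f)"
definition dist_l2 :: "'a l2 \<Rightarrow> 'a l2 \<Rightarrow> real" where "dist_l2 f g = norm (f - g)"
definition sgn_l2 :: "'a l2 \<Rightarrow> 'a l2" where "sgn_l2 f = inverse (norm f) *\<^sub>R f"
definition uniformity_l2 :: "('a l2 \<times> 'a l2) filter" where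
  "uniformity_l2 = (INF e\<in>{0 <..}. principal {(f, g). dist f g < e})"
definition open_l2 :: "'a l2 set \<Rightarrow> bool" where
  "open_l2 U \<longleftrightarrow> (\<forall>f\<in>U. \<forall>\<^sub>F (f', g) in uniformity. f' = f \<longrightarrow> g \<in> U)"

instance
proof
  fix f g h :: "'a l2" and r s :: real
  show "f + g + h = f + (g + h)" by transfer (simp add: add.assoc)
  show "f + g = g + f" by transfer (simp add: add.commute)
  show "0 + f = f" by transfer simp
  show "- f + f = 0" by transfer simp
  show "f - g = f + - g" by transfer simp
  show "r *\<^sub>R (f + g) = r *\<^sub>R f + r *\<^sub>R g" by transfer (simp add: distrib_left)
  show "(r + s) *\<^sub>R f = r *\<^sub>R f + s *\<^sub>R f" by transfer (simp add: distrib_right)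
  show "r *\<^sub>R s *\<^sub>R f = (r * s) *\<^sub>R f" by transfer (simp add: mult.assoc)
  show "1 *\<^sub>R f = f" by transfer simp
  show "inner f g = inner g f" by transfer (subst ell2_inner_commute, simp)
  show "inner (f + g) h = inner f h + inner g h" by transfer (simp add: ell2_inner_add_left)
  show "inner (r *\<^sub>R f) g = r * inner f g" by transfer (simp add: ell2_inner_scale_left)
  show "0 \<le> inner f f" by transfer (simp add: Re_ell2_inner_self infsum_nonneg)
  show "inner f f = 0 \<longleftrightarrow> f = 0"
  proof transfer
    fix f :: "'a \<Rightarrow> complex" assume f: "f \<in> ell2 UNIV"
    show "Re (ell2_inner UNIV f f) = 0 \<longleftrightarrow> f = (\<lambda>_. 0)"
    proof
      assume "Re (ell2_inner UNIV f f) = 0"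
      then have zero: "(\<Sum>\<^sub>\<infinity>x. (cmod (f x))\<^sup>2) = 0"
        unfolding Re_ell2_inner_self[OF f] .
      show "f = (\<lambda>_. 0)"
      proof
        fix x
        show "f x = 0"
          using nonneg_infsum_le_0D[of "\<lambda>x. (cmod (f x))\<^sup>2" UNIV x] ell2_summable[OF f] zero by simp
      qed
    qed (simp add: ell2_inner_def)
  qed
qed (rule dist_l2_def sgn_l2_def uniformity_l2_def open_l2_def norm_l2_def)+

end

lemma norm_l2_square: "(norm f)\<^sup>2 = (\<Sum>\<^sub>\<infinity>x. (cmod (fun_of f x))\<^sup>2)" for f :: "'a l2"
  by (subst power2_norm_eq_inner, transfer) (rule Re_ell2_inner_self)

lemma sum_le_norm_l2_square:
  assumes "finite S" shows "(\<Sum>x\<in>S. (cmod (fun_of f x))\<^sup>2) \<le> (norm f)\<^sup>2"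
  unfolding norm_l2_square using assms ell2_summable[OF fun_of]
  by (intro finite_sum_le_infsum) auto

lemma norm_l2_le:
  assumes "0 \<le> c" "\<And>S. finite S \<Longrightarrow> (\<Sum>x\<in>S. (cmod (fun_of f x))\<^sup>2) \<le> c\<^sup>2"
  shows "norm f \<le> c"
proof (rule power2_le_imp_le)
  show "(norm f)\<^sup>2 \<le> c\<^sup>2"
    unfolding norm_l2_square using assms(2) ell2_summable[OF fun_of]
    by (intro infsum_le_finite_sums) auto
qed fact

lemma fun_of_le_norm: "cmod (fun_of f x) \<le> norm f"
  using sum_le_norm_l2_square[of "{x}" f] by (auto intro: power2_le_imp_le)

lemma ell2_UNIV_if_bounded:
  assumes "\<And>S. finite S \<Longrightarrow> (\<Sum>x\<in>S. (cmod (f x))\<^sup>2) \<le> c"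
  shows "f \<in> ell2 UNIV"
  using assms by (auto simp: ell2_def intro!: nonneg_bdd_above_summable_on bdd_aboveI2)

text \<open>  A Cauchy sequence converges pointwise. The bound for the distance of two terms holds for every
  finite partial sum and survives the pointwise limit there, as in Fatou's lemma; this gives both
  square-summability of the limit and convergence in norm.\<close>

instance l2 :: (type) complete_space
proof
  fix X :: "nat \<Rightarrow> 'a l2"
  assume X: "Cauchy X"
  have "Cauchy (\<lambda>n. fun_of (X n) x)" for x
  proof (rule metric_CauchyI)
    fix e :: real assume "0 < e"
    then obtain N where "\<And>m n. m \<ge> N \<Longrightarrow> n \<ge> N \<Longrightarrow> dist (X m) (X n) < e"
      using X by (meson metric_CauchyD)
    moreover have "dist (fun_of (X m) x) (fun_of (X n) x) \<le> dist (X m) (X n)" for m n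
      using fun_of_le_norm[of "X m - X n" x] by (simp add: dist_norm minus_l2.rep_eq)
    ultimately show "\<exists>N. \<forall>m\<ge>N. \<forall>n\<ge>N. dist (fun_of (X m) x) (fun_of (X n) x) < e"
      using le_less_trans by blast
  qed
  then have "\<exists>l. (\<lambda>n. fun_of (X n) x) \<longlonglongrightarrow> l" for x
    using Cauchy_convergent_iff convergent_def by blast
  then obtain F where F: "\<And>x. (\<lambda>n. fun_of (X n) x) \<longlonglongrightarrow> F x" by metis
  have tail: "(\<Sum>x\<in>S. (cmod (fun_of (X n) x - F x))\<^sup>2) \<le> e\<^sup>2"
    if S: "finite S" and N: "\<And>m n. m \<ge> N \<Longrightarrow> n \<ge> N \<Longrightarrow> dist (X m) (X n) < e" and n: "n \<ge> N" for S N n e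
  proof (rule LIMSEQ_le_const2)
    show "(\<lambda>m. \<Sum>x\<in>S. (cmod (fun_of (X n) x - fun_of (X m) x))\<^sup>2)
        \<longlonglongrightarrow> (\<Sum>x\<in>S. (cmod (fun_of (X n) x - F x))\<^sup>2)"
      by (intro tendsto_intros F)
    have "(\<Sum>x\<in>S. (cmod (fun_of (X n) x - fun_of (X m) x))\<^sup>2) \<le> e\<^sup>2" if "m \<ge> N" for m
    proof -
      have "(\<Sum>x\<in>S. (cmod (fun_of (X n) x - fun_of (X m) x))\<^sup>2) \<le> (norm (X n - X m))\<^sup>2"
        using sum_le_norm_l2_square[OF S, of "X n - X m"] by (simp add: minus_l2.rep_eq)
      also have "\<dots> \<le> e\<^sup>2"
        using N[OF n that] by (intro power_mono) (auto simp: dist_norm)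
      finally show ?thesis .
    qed
    then show "\<exists>N. \<forall>m\<ge>N. (\<Sum>x\<in>S. (cmod (fun_of (X n) x - fun_of (X m) x))\<^sup>2) \<le> e\<^sup>2" by blast
  qed
  obtain N where N: "\<And>m n. m \<ge> N \<Longrightarrow> n \<ge> N \<Longrightarrow> dist (X m) (X n) < 1"
    using X by (meson metric_CauchyD zero_less_one)
  have "(\<lambda>x. fun_of (X N) x - F x) \<in> ell2 UNIV"
    using tail[OF _ N order_refl] by (rule ell2_UNIV_if_bounded)
  from ell2_diff[OF fun_of this, of "X N"] have "F \<in> ell2 UNIV" by simp
  then have F_eq: "fun_of (of_fun F) = F" by (rule of_fun_inverse)
  have "X \<longlonglongrightarrow> of_fun F"
  proof (rule metric_LIMSEQ_I)
    fix e :: real assume "0 < e"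
    then obtain N where N: "\<And>m n. m \<ge> N \<Longrightarrow> n \<ge> N \<Longrightarrow> dist (X m) (X n) < e/2"
      using X by (meson metric_CauchyD half_gt_zero)
    have "norm (X n - of_fun F) \<le> e/2" if "n \<ge> N" for n
      using tail[OF _ N that] \<open>0 < e\<close> by (intro norm_l2_le) (simp_all add: minus_l2.rep_eq F_eq)
    then show "\<exists>N. \<forall>n\<ge>N. dist (X n) (of_fun F) < e"
      using \<open>0 < e\<close> by (intro exI[of _ N]) (force simp: dist_norm)
  qed
  then show "convergent X" by (auto simp: convergent_def)
qed

lemma finsupp_subset_ell2: "finsupp V \<subseteq> ell2 V"
proof
  fix f assume f: "f \<in> finsupp V"
  have "(\<lambda>x. (cmod (f x))\<^sup>2) summable_on {x \<in> V. f x \<noteq> 0}"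
    using f by (intro summable_on_finite) (simp add: finsupp_def)
  also have "?this \<longleftrightarrow> (\<lambda>x. (cmod (f x))\<^sup>2) summable_on V"
    by (rule summable_on_cong_neutral) auto
  finally show "f \<in> ell2 V" using f by (simp add: ell2_def finsupp_def)
qed

lemma finsupp_dense:
  assumes f: "f \<in> ell2 V" and e: "0 < e"
  shows "\<exists>g\<in>finsupp V. ell2_norm V (\<lambda>x. f x - g x) < e"
proof -
  obtain S where S: "finite S" "S \<subseteq> V"
    and approx: "dist (\<Sum>x\<in>S. (cmod (f x))\<^sup>2) (\<Sum>\<^sub>\<infinity>x\<in>V. (cmod (f x))\<^sup>2) \<le> e\<^sup>2 / 2"
    using infsum_finite_approximation[OF ell2_summable[OF f], of "e\<^sup>2 / 2"] e by auto
  define g where "g x = (if x \<in> S then f x else 0)" for x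
  have g: "g \<in> finsupp V"
    using S by (auto simp: g_def finsupp_def intro: finite_subset)
  have "(\<Sum>\<^sub>\<infinity>x\<in>V. (cmod (f x - g x))\<^sup>2) = (\<Sum>\<^sub>\<infinity>x\<in>V - S. (cmod (f x))\<^sup>2)"
    by (rule infsum_cong_neutral) (auto simp: g_def)
  also have "\<dots> = (\<Sum>\<^sub>\<infinity>x\<in>V. (cmod (f x))\<^sup>2) - (\<Sum>\<^sub>\<infinity>x\<in>S. (cmod (f x))\<^sup>2)"
    using S ell2_summable[OF f] by (intro infsum_Diff) auto
  also have "\<dots> \<le> e\<^sup>2 / 2" using approx S(1) unfolding dist_real_def infsum_finite[OF S(1)] by linarith
  also have "\<dots> < e\<^sup>2" using e by simp
  finally have "(\<Sum>\<^sub>\<infinity>x\<in>V. (cmod (f x - g x))\<^sup>2) < e\<^sup>2" .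
  moreover have "(\<lambda>x. f x - g x) \<in> ell2 V"
    using f g finsupp_subset_ell2 by (blast intro: ell2_diff)
  ultimately have "ell2_norm V (\<lambda>x. f x - g x) < e"
    unfolding ell2_norm_def using e by (simp add: Re_ell2_inner_self real_less_lsqrt)
  then show ?thesis using g by blast
qed

section \<open>Green's formula\<close>

text \<open>  Reversing the edges turns \<open>- a y * \<psi> x y\<close> into \<open>a x * \<psi> x y\<close>: both ends contribute the same.\<close>

lemma sum_swap_antisymmetric:
  fixes a :: "'a \<Rightarrow> 'b::comm_ring_1"
  assumes sym: "\<And>x y. (x, y) \<in> F \<Longrightarrow> (y, x) \<in> F"
    and anti: "\<And>x y. \<psi> y x = - \<psi> x y"
  shows "(\<Sum>(x, y)\<in>F. (a x - a y) * \<psi> x y) = 2 * (\<Sum>(x, y)\<in>F. a x * \<psi> x y)"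
proof -
  have "(\<Sum>(x, y)\<in>F. a y * \<psi> x y) = (\<Sum>(x, y)\<in>F. a x * \<psi> y x)"
    by (rule sum.reindex_bij_witness[of _ prod.swap prod.swap]) (auto dest: sym)
  also have "\<dots> = - (\<Sum>(x, y)\<in>F. a x * \<psi> x y)"
    by (subst anti) (simp add: split_beta sum_negf)
  finally show ?thesis
    by (simp add: left_diff_distrib split_beta sum_subtractf)
qed

context locally_finite_graph
begin

text \<open>  The finite set \<open>F\<close> carries all nonzero terms, and each vertex starts only finitely many edges, so
  the infinite sum reduces to a finite double sum.\<close>

lemma sum_edges_by_initial_vertex:
  fixes K :: "'a \<Rightarrow> 'a \<Rightarrow> 'b::{comm_monoid_add, t2_space}"
  assumes F: "finite F" "F \<subseteq> oriented_edges E"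
    and zero: "\<And>x y. (x, y) \<in> oriented_edges E - F \<Longrightarrow> K x y = 0"
  shows "(\<Sum>(x, y)\<in>F. K x y) = (\<Sum>\<^sub>\<infinity>x. \<Sum>y | {x, y} \<in> E. K x y)"
proof -
  have "(\<Sum>(x, y)\<in>F. K x y) = (\<Sum>(x, y)\<in>(SIGMA x:fst ` F. {y. {x, y} \<in> E}). K x y)"
    using F finite_neighbours
    by (intro sum.mono_neutral_left) (force simp: oriented_edges_def intro!: zero)+
  also have "\<dots> = (\<Sum>x\<in>fst ` F. \<Sum>y | {x, y} \<in> E. K x y)"
    using F finite_neighbours by (intro sum.Sigma[symmetric]) auto
  also have "\<dots> = (\<Sum>\<^sub>\<infinity>x\<in>fst ` F. \<Sum>y | {x, y} \<in> E. K x y)"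
    using F by simp
  also have "\<dots> = (\<Sum>\<^sub>\<infinity>x. \<Sum>y | {x, y} \<in> E. K x y)"
    by (rule infsum_cong_neutral) (force simp: oriented_edges_def intro!: sum.neutral zero)+
  finally show ?thesis .
qed

definition edges_meeting_support :: "('a \<Rightarrow> complex) \<Rightarrow> ('a \<times> 'a) set" where
  "edges_meeting_support f = {(x, y). {x, y} \<in> E \<and> (f x \<noteq> 0 \<or> f y \<noteq> 0)}"

lemma edges_meeting_support_symmetric:
  "(x, y) \<in> edges_meeting_support f \<Longrightarrow> (y, x) \<in> edges_meeting_support f"
  by (auto simp: edges_meeting_support_def insert_commute)

lemma edges_meeting_support_oriented: "edges_meeting_support f \<subseteq> oriented_edges E"
  by (auto simp: edges_meeting_support_def oriented_edges_def)

lemma finite_edges_meeting_support: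
  assumes "finite {x. f x \<noteq> 0}"
  shows "finite (edges_meeting_support f)"
proof (rule finite_subset)
  show "edges_meeting_support f
      \<subseteq> (\<Union>x\<in>{x. f x \<noteq> 0}. Pair x ` {y. {x, y} \<in> E} \<union> (\<lambda>y. (y, x)) ` {y. {x, y} \<in> E})"
    by (auto simp: edges_meeting_support_def insert_commute)
  show "finite \<dots>" using assms finite_neighbours by simp
qed

lemma edge_inner_coboundary:
  assumes "finite {x. f x \<noteq> 0}"
  shows "edge_inner E (coboundary E f) (coboundary E g)
      = 1 / 2 * (\<Sum>(x, y)\<in>edges_meeting_support f. (f x - f y) * cnj (g x - g y))"
proof -
  let ?K = "\<lambda>(x, y). (f x - f y) * cnj (g x - g y)"
  have "(\<Sum>\<^sub>\<infinity>e\<in>oriented_edges E. coboundary E f e * cnj (coboundary E g e))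
      = (\<Sum>\<^sub>\<infinity>e\<in>edges_meeting_support f. ?K e)"
    using edges_meeting_support_oriented[of f]
    by (intro infsum_cong_neutral)
      (auto simp: coboundary_def edges_meeting_support_def oriented_edges_def)
  then show ?thesis
    using finite_edges_meeting_support[OF assms] by (simp add: edge_inner_def)
qed

text \<open>  The antisymmetric factor is \<open>df\<close>, and the factor \<open>cnj (dg)\<close> is split into its two ends.\<close>

lemma green_left:
  assumes "finite {x. f x \<noteq> 0}"
  shows "edge_inner E (coboundary E f) (coboundary E g) = ell2_inner UNIV (laplacian E f) g"
proof -
  let ?F = "edges_meeting_support f"
  have "(\<Sum>(x, y)\<in>?F. (f x - f y) * cnj (g x - g y)) = (\<Sum>(x, y)\<in>?F. (cnj (g x) - cnj (g y)) * (f x - f y))"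
    by (simp add: mult.commute)
  also have "\<dots> = 2 * (\<Sum>(x, y)\<in>?F. cnj (g x) * (f x - f y))"
    by (rule sum_swap_antisymmetric) (auto dest: edges_meeting_support_symmetric)
  also have "(\<Sum>(x, y)\<in>?F. cnj (g x) * (f x - f y)) = (\<Sum>\<^sub>\<infinity>x. \<Sum>y | {x, y} \<in> E. cnj (g x) * (f x - f y))"
    using finite_edges_meeting_support[OF assms] edges_meeting_support_oriented
    by (rule sum_edges_by_initial_vertex)
      (auto simp: edges_meeting_support_def oriented_edges_def)
  also have "\<dots> = ell2_inner UNIV (laplacian E f) g"
    by (simp add: ell2_inner_def laplacian_def sum_distrib_left mult.commute)
  finally show ?thesis by (simp add: edge_inner_coboundary[OF assms])
qed

text \<open>  Here \<open>cnj (dg)\<close> is the antisymmetric factor and \<open>df\<close> is split. Exchanging \<open>f\<close> and \<open>g\<close> in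
  \<open>green_left\<close> would demand finite support of \<open>g\<close>, whereas the adjoint is computed by pairing with
  arbitrary \<open>g\<close>.\<close>

lemma green_right:
  assumes "finite {x. f x \<noteq> 0}"
  shows "edge_inner E (coboundary E f) (coboundary E g) = ell2_inner UNIV f (laplacian E g)"
proof -
  let ?F = "edges_meeting_support f"
  have fibre: "(\<Sum>y | {x, y} \<in> E. f x * cnj (g x - g y)) = f x * cnj (laplacian E g x)" for x
    by (simp add: laplacian_def sum_distrib_left)
  have "(\<Sum>(x, y)\<in>?F. (f x - f y) * cnj (g x - g y)) = 2 * (\<Sum>(x, y)\<in>?F. f x * cnj (g x - g y))"
    by (rule sum_swap_antisymmetric) (auto dest: edges_meeting_support_symmetric)
  also have "(\<Sum>(x, y)\<in>?F. f x * cnj (g x - g y)) = (\<Sum>\<^sub>\<infinity>x. \<Sum>y | {x, y} \<in> E. f x * cnj (g x - g y))"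
    using finite_edges_meeting_support[OF assms] edges_meeting_support_oriented
    by (rule sum_edges_by_initial_vertex)
      (auto simp: edges_meeting_support_def oriented_edges_def)
  also have "\<dots> = ell2_inner UNIV f (laplacian E g)"
    by (simp only: ell2_inner_def fibre)
  finally show ?thesis by (simp add: edge_inner_coboundary[OF assms])
qed

end

lemma Re_edge_inner_self_nonneg: "0 \<le> Re (edge_inner E \<phi> \<phi>)"
proof (cases "(\<lambda>e. \<phi> e * cnj (\<phi> e)) summable_on oriented_edges E")
  case True
  then show ?thesis
    by (simp add: edge_inner_def infsum_Re[symmetric] infsum_nonneg)
qed (simp add: edge_inner_def infsum_not_exists)

section \<open>The Laplacian with finitely supported domain\<close>

lemma finite_superlevel_if_summable:
  fixes f :: "'a \<Rightarrow> real"
  assumes f: "f summable_on A" and nonneg: "\<And>x. x \<in> A \<Longrightarrow> 0 \<le> f x" and e: "0 < e"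
  shows "finite {x \<in> A. e \<le> f x}"
proof (rule ccontr)
  assume inf: "infinite {x \<in> A. e \<le> f x}"
  obtain n :: nat where n: "infsum f A < real n * e"
    using reals_Archimedean3[OF e] by blast
  obtain S where S: "S \<subseteq> {x \<in> A. e \<le> f x}" "finite S" "card S = n"
    using infinite_arbitrarily_large[OF inf] by blast
  have "real n * e \<le> sum f S"
    using S by (intro order_trans[OF _ sum_bounded_below[of S e f]]) auto
  also have "\<dots> \<le> infsum f A"
    using S f nonneg by (intro finite_sum_le_infsum) auto
  finally show False using n by simp
qed

lemma ell2_inner_point:
  "ell2_inner UNIV (\<lambda>y. if y = x then c else 0) g = c * cnj (g x)"
proof -
  have "ell2_inner UNIV (\<lambda>y. if y = x then c else 0) g = (\<Sum>\<^sub>\<infinity>y\<in>{x}. c * cnj (g y))"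
    unfolding ell2_inner_def by (rule infsum_cong_neutral) auto
  then show ?thesis by simp
qed

lemma laplacian_add: "laplacian E (\<lambda>x. f x + g x) = (\<lambda>x. laplacian E f x + laplacian E g x)"
  by (simp add: laplacian_def fun_eq_iff sum.distrib[symmetric] algebra_simps)

lemma laplacian_scale: "laplacian E (\<lambda>x. c * f x) = (\<lambda>x. c * laplacian E f x)"
  by (simp add: laplacian_def fun_eq_iff sum_distrib_left algebra_simps)

lemma laplacian_zero: "laplacian E (\<lambda>_. 0) = (\<lambda>_. 0)"
  by (simp add: laplacian_def fun_eq_iff)

lemma finsupp_add: "f \<in> finsupp V \<Longrightarrow> g \<in> finsupp V \<Longrightarrow> (\<lambda>x. f x + g x) \<in> finsupp V"
  unfolding finsupp_def
  by (auto intro: finite_subset[of _ "{x \<in> V. f x \<noteq> 0} \<union> {x \<in> V. g x \<noteq> 0}"])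

lemma finsupp_scale: "f \<in> finsupp V \<Longrightarrow> (\<lambda>x. c * f x) \<in> finsupp V"
  unfolding finsupp_def by (auto intro: finite_subset[of _ "{x \<in> V. f x \<noteq> 0}"])

lemma finsupp_point: "x \<in> V \<Longrightarrow> (\<lambda>y. if y = x then c else 0) \<in> finsupp V"
  by (auto simp: finsupp_def)

lemma finsupp_finite:
  assumes "f \<in> finsupp V" shows "finite {x. f x \<noteq> 0}"
proof -
  have "{x. f x \<noteq> 0} = {x \<in> V. f x \<noteq> 0}" using assms by (auto simp: finsupp_def)
  then show ?thesis using assms by (simp add: finsupp_def)
qed

lemma inner_of_fun:
  "f \<in> ell2 UNIV \<Longrightarrow> g \<in> ell2 UNIV \<Longrightarrow> inner (of_fun f) (of_fun g) = Re (ell2_inner UNIV f g)"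
  by (simp add: inner_l2.rep_eq of_fun_inverse)

lemma of_fun_add:
  "f \<in> ell2 UNIV \<Longrightarrow> g \<in> ell2 UNIV \<Longrightarrow> of_fun f + of_fun g = of_fun (\<lambda>x. f x + g x)"
  by (simp add: plus_l2_def of_fun_inverse)

lemma of_fun_scaleR:
  "f \<in> ell2 UNIV \<Longrightarrow> r *\<^sub>R of_fun f = of_fun (\<lambda>x. complex_of_real r * f x)"
  by (simp add: scaleR_l2_def of_fun_inverse)

lemma of_fun_zero: "of_fun (\<lambda>_. 0) = 0"
  by (simp add: zero_l2_def)

context locally_finite_graph
begin

lemma laplacian_vanishes: "x \<notin> V \<Longrightarrow> laplacian E f x = 0"
  unfolding laplacian_def using edge_vertices by (intro sum.neutral) blast

lemma laplacian_finsupp_UNIV: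
  assumes "f \<in> finsupp UNIV"
  shows "laplacian E f \<in> finsupp UNIV"
proof -
  have "laplacian E f x = 0" if "x \<notin> fst ` edges_meeting_support f" for x
    unfolding laplacian_def
    by (rule sum.neutral) (use that in \<open>force simp: edges_meeting_support_def\<close>)
  then have "{x. laplacian E f x \<noteq> 0} \<subseteq> fst ` edges_meeting_support f" by blast
  then show ?thesis
    using finite_edges_meeting_support[OF finsupp_finite[OF assms]]
    by (auto simp: finsupp_def intro: finite_subset)
qed

lemma finsupp_UNIV_ell2:
  assumes "f \<in> finsupp UNIV"
  shows "f \<in> ell2 UNIV" and "laplacian E f \<in> ell2 UNIV"
  using assms laplacian_finsupp_UNIV finsupp_subset_ell2 by blast+

lemma laplacian_transpose:
  assumes "finite {x. f x \<noteq> 0}"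
  shows "ell2_inner UNIV (laplacian E f) g = ell2_inner UNIV f (laplacian E g)"
  using green_left[OF assms] green_right[OF assms] by simp

text \<open>  The maximum principle: at a vertex \<open>z\<close> where \<open>\<bar>r\<bar>\<close> is maximal, the eigenvalue equation bounds
  \<open>(m(z) + 1) * \<bar>r z\<bar>\<close> by the sum of \<open>\<bar>r y\<bar>\<close> over the \<open>m(z)\<close> neighbours. The maximum exists because
  the values of a square-summable function exceed any positive level only finitely often.\<close>

lemma laplacian_no_negative_eigenfunction:
  assumes r: "r \<in> ell2 UNIV" and eigen: "\<And>x. laplacian E r x = - r x"
  shows "r x = 0"
proof (rule ccontr)
  assume nz: "r x \<noteq> 0"
  define A where "A = {y. (cmod (r x))\<^sup>2 \<le> (cmod (r y))\<^sup>2}"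
  have "finite A"
    unfolding A_def using finite_superlevel_if_summable[OF ell2_summable[OF r], of "(cmod (r x))\<^sup>2"] nz by simp
  moreover have "x \<in> A" by (simp add: A_def)
  ultimately have "Max ((\<lambda>y. cmod (r y)) ` A) \<in> (\<lambda>y. cmod (r y)) ` A"
    by (intro Max_in) auto
  then obtain z where "cmod (r z) = Max ((\<lambda>y. cmod (r y)) ` A)" by force
  with \<open>finite A\<close> have z: "cmod (r y) \<le> cmod (r z)" if "y \<in> A" for y
    using that by simp
  have xz: "cmod (r x) \<le> cmod (r z)" using z \<open>x \<in> A\<close> .
  have max: "cmod (r y) \<le> cmod (r z)" for y
  proof (cases "y \<in> A")
    case False
    then have "cmod (r y) < cmod (r x)"
      by (auto simp: A_def not_le intro: power_less_imp_less_base)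
    then show ?thesis using xz by simp
  qed (rule z)
  let ?N = "{y. {z, y} \<in> E}"
  have "of_nat (Suc (card ?N)) * r z = (\<Sum>y\<in>?N. r y)"
    using eigen[of z] by (simp add: laplacian_def sum_subtractf algebra_simps)
  then have "cmod (of_nat (Suc (card ?N)) * r z) \<le> (\<Sum>y\<in>?N. cmod (r y))"
    by (simp only: norm_sum)
  also have "\<dots> \<le> of_nat (card ?N) * cmod (r z)"
    by (rule sum_bounded_above) (rule max)
  finally have "cmod (r z) \<le> 0"
    unfolding norm_mult norm_of_nat by (simp add: algebra_simps)
  then show False using xz nz by simp
qed

text \<open>  The operator \<open>\<Delta>\<close> on the functions of finite support, as a graph in the Hilbert space. The support
  may leave \<open>V\<close>: otherwise functions supported off \<open>V\<close> would be orthogonal to the range of \<open>1 + \<Delta>\<close>.\<close>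

definition laplacian_core :: "('a l2 \<times> 'a l2) set" where
  "laplacian_core = (\<lambda>f. (of_fun f, of_fun (laplacian E f))) ` finsupp UNIV"

lemma subspace_laplacian_core: "subspace laplacian_core"
proof (rule subspaceI)
  have "(\<lambda>_. 0) \<in> finsupp (UNIV :: 'a set)" by (simp add: finsupp_def)
  then show "0 \<in> laplacian_core"
    unfolding laplacian_core_def by (rule rev_image_eqI) (simp add: laplacian_zero of_fun_zero zero_prod_def)
next
  fix u v assume "u \<in> laplacian_core" "v \<in> laplacian_core"
  then obtain f g where "f \<in> finsupp UNIV" "g \<in> finsupp UNIV"
    and "u = (of_fun f, of_fun (laplacian E f))" "v = (of_fun g, of_fun (laplacian E g))"
    by (auto simp: laplacian_core_def)
  then show "u + v \<in> laplacian_core"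
    unfolding laplacian_core_def
    by (intro rev_image_eqI[of "\<lambda>x. f x + g x"])
      (auto simp: finsupp_add laplacian_add of_fun_add finsupp_UNIV_ell2)
next
  fix r :: real and u assume "u \<in> laplacian_core"
  then obtain f where "f \<in> finsupp UNIV" "u = (of_fun f, of_fun (laplacian E f))"
    by (auto simp: laplacian_core_def)
  then show "r *\<^sub>R u \<in> laplacian_core"
    unfolding laplacian_core_def
    by (intro rev_image_eqI[of "\<lambda>x. complex_of_real r * f x"])
      (auto simp: finsupp_scale laplacian_scale of_fun_scaleR finsupp_UNIV_ell2)
qed

lemma laplacian_core_nonneg:
  assumes "(u, u') \<in> laplacian_core"
  shows "0 \<le> inner u' u"
proof -
  obtain f where f: "f \<in> finsupp UNIV" and u: "u = of_fun f" "u' = of_fun (laplacian E f)"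
    using assms by (auto simp: laplacian_core_def)
  note finsupp_UNIV_ell2[OF f]
  then have "inner u' u = Re (edge_inner E (coboundary E f) (coboundary E f))"
    by (simp add: u inner_of_fun green_left[OF finsupp_finite[OF f]])
  then show ?thesis by (simp add: Re_edge_inner_self_nonneg)
qed

lemma laplacian_core_adjoint:
  assumes "(u, u') \<in> laplacian_core" and g: "g \<in> ell2 UNIV" "laplacian E g \<in> ell2 UNIV"
  shows "inner u' (of_fun g) = inner u (of_fun (laplacian E g))"
proof -
  obtain f where f: "f \<in> finsupp UNIV" and u: "u = of_fun f" "u' = of_fun (laplacian E f)"
    using assms by (auto simp: laplacian_core_def)
  note finsupp_UNIV_ell2[OF f]
  then show ?thesis
    using g by (simp add: u inner_of_fun laplacian_transpose[OF finsupp_finite[OF f]])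
qed

text \<open>  Testing against multiples of point masses shows \<open>\<Delta> r = - r\<close> pointwise, so the maximum principle
  applies.\<close>

lemma laplacian_core_trivial_deficiency:
  assumes orth: "\<And>u u'. (u, u') \<in> laplacian_core \<Longrightarrow> inner (u + u') r = 0"
  shows "r = 0"
proof -
  let ?r = "fun_of r"
  have "laplacian E ?r x = - ?r x" for x
  proof -
    \<comment> \<open>The inner product is a real part; this value of the test function turns it into \<open>\<bar>c\<bar>\<^sup>2\<close>.\<close>
    define c where "c = ?r x + laplacian E ?r x"
    define f where "f = (\<lambda>y. if y = x then c else 0)"
    have f: "f \<in> finsupp UNIV" by (simp add: f_def finsupp_point)
    note ell2 = finsupp_UNIV_ell2[OF f]
    have "ell2_inner UNIV (\<lambda>y. f y + laplacian E f y) ?r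
        = ell2_inner UNIV f ?r + ell2_inner UNIV f (laplacian E ?r)"
      using ell2 fun_of[of r]
      by (simp add: ell2_inner_add_left laplacian_transpose[OF finsupp_finite[OF f]])
    also have "\<dots> = c * cnj c"
      by (simp add: f_def ell2_inner_point c_def algebra_simps)
    finally have "inner (of_fun f + of_fun (laplacian E f)) r = Re (c * cnj c)"
      using ell2 by (simp add: of_fun_add inner_l2.rep_eq of_fun_inverse ell2_add)
    moreover have "inner (of_fun f + of_fun (laplacian E f)) r = 0"
      using f by (intro orth) (simp add: laplacian_core_def)
    ultimately have "Re (c * cnj c) = 0" by simp
    then have "c = 0" by (simp add: complex_eq_iff sum_power2_eq_zero_iff flip: power2_eq_square)
    then show ?thesis by (simp add: c_def eq_neg_iff_add_eq_0 add.commute)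
  qed
  then have "?r x = 0" for x
    using laplacian_no_negative_eigenfunction[OF fun_of[of r]] by blast
  then have "?r = fun_of 0" by (simp add: zero_l2.rep_eq fun_eq_iff)
  then show ?thesis by (simp add: fun_of_inject)
qed

section \<open>The maximal Laplacian is the self-adjoint extension\<close>

definition maximal_laplacian :: "'a operator" where
  "maximal_laplacian = {(f, laplacian E f) | f. f \<in> ell2 V \<and> laplacian E f \<in> ell2 V}"

lemma maximal_laplacian_in_closure:
  assumes "(f, h) \<in> maximal_laplacian"
  shows "(of_fun f, of_fun h) \<in> closure laplacian_core"
proof -
  have f: "h = laplacian E f" "f \<in> ell2 UNIV" "laplacian E f \<in> ell2 UNIV"
    using assms by (auto simp: maximal_laplacian_def intro: ell2_mono)
  show ?thesis
    unfolding f(1)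
  proof (rule adjoint_in_closure[OF subspace_laplacian_core])
    fix u u' v v' assume uv: "(u, u') \<in> laplacian_core" "(v, v') \<in> laplacian_core"
    then show "inner u' v = inner u v'"
      by (auto simp: laplacian_core_def finsupp_UNIV_ell2 intro!: laplacian_core_adjoint)
  qed (fact laplacian_core_nonneg laplacian_core_trivial_deficiency laplacian_core_adjoint[OF _ f(2,3)])+
qed

text \<open>  The second pair is an adjoint pair for the core, and the first one is a limit of pairs of the core;
  hence the equation of real parts. Applied to \<open>\<i> f\<close> it yields the imaginary parts.\<close>

lemma maximal_laplacian_symmetric:
  assumes f: "(f, f') \<in> maximal_laplacian" and g: "(g, g') \<in> maximal_laplacian"
  shows "ell2_inner V f' g = ell2_inner V f g'"
proof -
  have g': "g' = laplacian E g" "g \<in> ell2 V" "g' \<in> ell2 V"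
    using g by (auto simp: maximal_laplacian_def)
  have Re_eq: "Re (ell2_inner V u' g) = Re (ell2_inner V u g')" if u: "(u, u') \<in> maximal_laplacian" for u u'
  proof -
    have "inner (of_fun u') (of_fun g) = inner (of_fun u) (of_fun g')"
    proof (rule adjoint_pairing_on_closure)
      show "(of_fun u, of_fun u') \<in> closure laplacian_core"
        using u by (rule maximal_laplacian_in_closure)
      show "inner v' (of_fun g) = inner v (of_fun g')" if "(v, v') \<in> laplacian_core" for v v'
        unfolding g'(1) using that g' by (intro laplacian_core_adjoint) (auto intro: ell2_mono)
    qed
    moreover have "u \<in> ell2 V" "u' \<in> ell2 V" using u by (auto simp: maximal_laplacian_def)
    ultimately show ?thesis
      using g' by (simp add: inner_of_fun ell2_mono[of _ V UNIV] ell2_inner_eq_UNIV ell2_vanishes)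
  qed
  have "((\<lambda>x. \<i> * f x), (\<lambda>x. \<i> * f' x)) \<in> maximal_laplacian"
    using f by (auto simp: maximal_laplacian_def laplacian_scale ell2_scale)
  from Re_eq[OF f] Re_eq[OF this] show ?thesis
    by (simp add: ell2_inner_scale_left complex_eq_iff)
qed

text \<open>  Nonnegativity of the real part extends from the core to its closure; the imaginary part vanishes by
  symmetry.\<close>

lemma maximal_laplacian_positive: "positive_operator V maximal_laplacian"
  unfolding positive_operator_def
proof safe
  fix f h assume fh: "(f, h) \<in> maximal_laplacian"
  have ell2: "f \<in> ell2 V" "h \<in> ell2 V" using fh by (auto simp: maximal_laplacian_def)
  have "0 \<le> inner (of_fun h) (of_fun f)"
    using laplacian_core_nonneg maximal_laplacian_in_closure[OF fh] by (rule nonneg_on_closure)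
  then have "0 \<le> Re (ell2_inner V h f)"
    using ell2 by (simp add: inner_of_fun ell2_mono[of _ V UNIV] ell2_inner_eq_UNIV ell2_vanishes)
  moreover have "ell2_inner V h f = cnj (ell2_inner V h f)"
    using maximal_laplacian_symmetric[OF fh fh] ell2_inner_commute[of V f h] by simp
  then have "Im (ell2_inner V h f) = 0"
    by (simp add: complex_eq_iff)
  ultimately show "ell2_inner V h f \<in> \<real>\<^sub>\<ge>\<^sub>0"
    by (simp add: complex_nonneg_Reals_iff)
qed

lemma laplacian_op_subset_maximal: "laplacian_op V E \<subseteq> maximal_laplacian"
  using finsupp_ell2 laplacian_finsupp by (auto simp: laplacian_op_def maximal_laplacian_def)

text \<open>  Pairing an element of the adjoint with point masses determines its values.\<close>

lemma adjoint_laplacian_op: "adjoint_op V (laplacian_op V E) = maximal_laplacian"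
proof (intro equalityI subsetI)
  fix p assume "p \<in> adjoint_op V (laplacian_op V E)"
  then obtain g h where p: "p = (g, h)" and gh: "g \<in> ell2 V" "h \<in> ell2 V"
    and adj: "\<And>f. f \<in> finsupp V \<Longrightarrow> ell2_inner V (laplacian E f) g = ell2_inner V f h"
    by (auto simp: adjoint_op_def laplacian_op_def)
  have "h x = laplacian E g x" for x
  proof (cases "x \<in> V")
    case True
    define f :: "'a \<Rightarrow> complex" where "f = (\<lambda>y. if y = x then 1 else 0)"
    have f: "f \<in> finsupp V" using True by (simp add: f_def finsupp_point)
    have "ell2_inner UNIV f h = ell2_inner UNIV f (laplacian E g)"
      using adj[OF f] laplacian_transpose[OF finsupp_finite[OF f], of g] gh
      by (simp add: ell2_inner_eq_UNIV ell2_vanishes)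
    then show ?thesis by (simp add: f_def ell2_inner_point)
  next
    case False
    then show ?thesis using gh ell2_vanishes laplacian_vanishes by metis
  qed
  then have "h = laplacian E g" by blast
  then show "p \<in> maximal_laplacian" using p gh by (simp add: maximal_laplacian_def)
next
  fix p assume p: "p \<in> maximal_laplacian"
  then have "\<And>f. f \<in> finsupp V \<Longrightarrow> ell2_inner V (laplacian E f) (fst p) = ell2_inner V f (snd p)"
    using laplacian_op_subset_maximal
    by (intro maximal_laplacian_symmetric) (auto simp: laplacian_op_def)
  then show "p \<in> adjoint_op V (laplacian_op V E)"
    using p by (auto simp: adjoint_op_def laplacian_op_def maximal_laplacian_def)
qed

end

lemma adjoint_op_antimono: "S \<subseteq> T \<Longrightarrow> adjoint_op V T \<subseteq> adjoint_op V S"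
  by (auto simp: adjoint_op_def)

context locally_finite_graph
begin

lemma adjoint_maximal_laplacian: "adjoint_op V maximal_laplacian = maximal_laplacian"
proof
  show "adjoint_op V maximal_laplacian \<subseteq> maximal_laplacian"
    using adjoint_op_antimono[OF laplacian_op_subset_maximal] adjoint_laplacian_op by blast
  show "maximal_laplacian \<subseteq> adjoint_op V maximal_laplacian"
    using maximal_laplacian_symmetric
    by (fastforce simp: adjoint_op_def maximal_laplacian_def)
qed

lemma self_adjoint_maximal_laplacian: "self_adjoint V maximal_laplacian"
  unfolding self_adjoint_def
proof (intro conjI adjoint_maximal_laplacian)
  show "linear_operator V maximal_laplacian"
    unfolding linear_operator_def maximal_laplacian_def
    by (auto simp: single_valued_def laplacian_zero laplacian_add laplacian_scale
        ell2_zero ell2_add ell2_scale)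
  have "finsupp V \<subseteq> Domain maximal_laplacian"
    using laplacian_op_subset_maximal by (auto simp: laplacian_op_def)
  then show "densely_defined V maximal_laplacian"
    unfolding densely_defined_def using finsupp_dense by blast
qed

text \<open>  Taking adjoints reverses inclusions: a self-adjoint extension \<open>A\<close> lies in the adjoint of
  \<open>laplacian_op V E\<close>, which is the maximal operator, and therefore contains the adjoint of the maximal
  operator, which is the maximal operator again.\<close>

lemma bar_laplacian_eq_maximal: "bar_laplacian V E = maximal_laplacian"
  unfolding bar_laplacian_def
proof (rule the_equality)
  show "self_adjoint V maximal_laplacian \<and> laplacian_op V E \<subseteq> maximal_laplacian"
    using self_adjoint_maximal_laplacian laplacian_op_subset_maximal by blast
  fix A assume A: "self_adjoint V A \<and> laplacian_op V E \<subseteq> A"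
  then have "adjoint_op V A \<subseteq> adjoint_op V (laplacian_op V E)"
    by (intro adjoint_op_antimono) simp
  then have sub: "A \<subseteq> maximal_laplacian"
    using A by (simp add: self_adjoint_def adjoint_laplacian_op)
  then have "maximal_laplacian \<subseteq> A"
    using A adjoint_op_antimono[OF sub, of V] by (simp add: self_adjoint_def adjoint_maximal_laplacian)
  with sub show "A = maximal_laplacian" by simp
qed

end

theorem proposition3p2:
  fixes V :: "'a set" and E :: "'a set set"
  assumes "locally_finite_graph V E"
  shows "(\<forall>f \<in> finsupp V. \<forall>g \<in> finsupp V.
            edge_inner E (coboundary E f) (coboundary E g) = ell2_inner V (laplacian E f) g)
       \<and> positive_operator V (bar_laplacian V E)"
proof -
  interpret locally_finite_graph V E by fact
  have "edge_inner E (coboundary E f) (coboundary E g) = ell2_inner V (laplacian E f) g"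
    if "f \<in> finsupp V" for f g
    using green_left[OF finsupp_finite[OF that]] laplacian_vanishes
    by (simp add: ell2_inner_eq_UNIV)
  then show ?thesis
    using maximal_laplacian_positive bar_laplacian_eq_maximal by simp
qed

end
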